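(* Let $M\subset\mathbb R^3$ be a smooth oriented surface with a local principal chart $(u,v)$, first fundamental form $I=E\,du^2+G\,dv^2$, second fundamental form $II=e\,du^2+g\,dv^2$, and principal curvatures $k_1=e/E$, $k_2=g/G$. Let $c(s)=(u(s),v(s))$ be a curve parametrized by arc length $s$ making an angle $\alpha(s)$ with the principal direction $(1,0)$, so that $(u',v')=\left(\frac{\cos\alpha}{\sqrt E},\frac{\sin\alpha}{\sqrt G}\right)$. If $c$ is a Darboux curve, then $$3(k_1-k_2)\sin\alpha\cos\alpha\,\frac{d\alpha}{ds}=\frac1{\sqrt E}\frac{\partial k_1}{\partial u}\cos^3\alpha+\frac1{\sqrt G}\frac{\partial k_2}{\partial v}\sin^3\alpha .$$
   Context: A principal chart is a chart whose coordinate curves are lines of curvature. A Darboux curve on $M$ is a curve such that at each of its points its osculating sphere (the sphere or plane having contact of order at least 3 with the curve) is tangent to $M$; equivalently it satisfies $k_n'+\tau_gk_g=0$, where $k_n,k_g,\tau_g$ are the normal curvature, geodesic curvature and geodesic torsion, with $\tau_g=(k_2-k_1)\cos\alpha\sin\alpha$. *)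

theory Defs
  imports "HOL-Analysis.Analysis"
begin

text \<open>The recursion is meant for open sets, since it uses the derivative at a point of the
  ambient space.\<close>

primrec C_k_on ::
  "nat \<Rightarrow> 'a::euclidean_space set \<Rightarrow> ('a \<Rightarrow> 'b::real_normed_vector) \<Rightarrow> bool" where
  "C_k_on 0 S f \<longleftrightarrow> continuous_on S f"
| "C_k_on (Suc k) S f \<longleftrightarrow> (\<forall>x\<in>S. f differentiable (at x)) \<and>
     (\<forall>h. C_k_on k S (\<lambda>x. frechet_derivative f (at x) h))"

definition smooth_on :: "'a::euclidean_space set \<Rightarrow> ('a \<Rightarrow> 'b::real_normed_vector) \<Rightarrow> bool" where
  "smooth_on S f \<longleftrightarrow> (\<forall>k. C_k_on k S f)"

definition d_u :: "(real \<times> real \<Rightarrow> 'b::real_normed_vector) \<Rightarrow> real \<times> real \<Rightarrow> 'b" where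
  "d_u f p = vector_derivative (\<lambda>t. f (t, snd p)) (at (fst p))"

definition d_v :: "(real \<times> real \<Rightarrow> 'b::real_normed_vector) \<Rightarrow> real \<times> real \<Rightarrow> 'b" where
  "d_v f p = vector_derivative (\<lambda>t. f (fst p, t)) (at (snd p))"

text \<open>A chart is given by its inverse, the local parametrization \<open>X\<close> of the surface.\<close>

definition chart :: "(real^3) set \<Rightarrow> (real \<times> real) set \<Rightarrow> (real \<times> real \<Rightarrow> real^3) \<Rightarrow> bool" where
  "chart M U X \<longleftrightarrow> open U \<and> smooth_on U X
     \<and> openin (top_of_set M) (X ` U) \<and> (\<exists>Y. homeomorphism U (X ` U) X Y)
     \<and> (\<forall>p\<in>U. inj (frechet_derivative X (at p)))"

definition smooth_surface :: "(real^3) set \<Rightarrow> bool" where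
  "smooth_surface M \<longleftrightarrow> (\<forall>p\<in>M. \<exists>U X. chart M U X \<and> p \<in> X ` U)"

definition tangent_space :: "(real^3) set \<Rightarrow> real^3 \<Rightarrow> (real^3) set" where
  "tangent_space M p = {w. \<exists>\<gamma> \<epsilon>. \<epsilon> > 0 \<and> smooth_on {-\<epsilon><..<\<epsilon>} \<gamma> \<and> \<gamma> ` {-\<epsilon><..<\<epsilon>} \<subseteq> M
     \<and> \<gamma> 0 = p \<and> (\<gamma> has_vector_derivative w) (at (0::real))}"

text \<open>An orientation is a smooth unit normal field. No compatibility between \<open>N\<close> and the order
  of the coordinates of a chart is imposed.\<close>

definition orientation :: "(real^3) set \<Rightarrow> (real^3 \<Rightarrow> real^3) \<Rightarrow> bool" where
  "orientation M N \<longleftrightarrow> (\<forall>U X. chart M U X \<longrightarrow> smooth_on U (N \<circ> X))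
     \<and> (\<forall>p\<in>M. norm (N p) = 1 \<and> (\<forall>w\<in>tangent_space M p. N p \<bullet> w = 0))"

definition coeff_E :: "(real \<times> real \<Rightarrow> real^3) \<Rightarrow> real \<times> real \<Rightarrow> real" where
  "coeff_E X p = d_u X p \<bullet> d_u X p"

definition coeff_F :: "(real \<times> real \<Rightarrow> real^3) \<Rightarrow> real \<times> real \<Rightarrow> real" where
  "coeff_F X p = d_u X p \<bullet> d_v X p"

definition coeff_G :: "(real \<times> real \<Rightarrow> real^3) \<Rightarrow> real \<times> real \<Rightarrow> real" where
  "coeff_G X p = d_v X p \<bullet> d_v X p"

definition coeff_e ::
  "(real \<times> real \<Rightarrow> real^3) \<Rightarrow> (real^3 \<Rightarrow> real^3) \<Rightarrow> real \<times> real \<Rightarrow> real" where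
  "coeff_e X N p = d_u (d_u X) p \<bullet> N (X p)"

definition coeff_f ::
  "(real \<times> real \<Rightarrow> real^3) \<Rightarrow> (real^3 \<Rightarrow> real^3) \<Rightarrow> real \<times> real \<Rightarrow> real" where
  "coeff_f X N p = d_v (d_u X) p \<bullet> N (X p)"

definition coeff_g ::
  "(real \<times> real \<Rightarrow> real^3) \<Rightarrow> (real^3 \<Rightarrow> real^3) \<Rightarrow> real \<times> real \<Rightarrow> real" where
  "coeff_g X N p = d_v (d_v X) p \<bullet> N (X p)"

definition curvature_1 ::
  "(real \<times> real \<Rightarrow> real^3) \<Rightarrow> (real^3 \<Rightarrow> real^3) \<Rightarrow> real \<times> real \<Rightarrow> real" where
  "curvature_1 X N p = coeff_e X N p / coeff_E X p"

definition curvature_2 ::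
  "(real \<times> real \<Rightarrow> real^3) \<Rightarrow> (real^3 \<Rightarrow> real^3) \<Rightarrow> real \<times> real \<Rightarrow> real" where
  "curvature_2 X N p = coeff_g X N p / coeff_G X p"

text \<open>The velocity is an eigenvector of the shape operator \<open>- dN\<close>, where \<open>dN\<close> applied to the
  velocity of \<open>\<gamma>\<close> is the derivative of \<open>N\<close> along \<open>\<gamma>\<close>.\<close>

definition line_of_curvature ::
  "(real^3 \<Rightarrow> real^3) \<Rightarrow> real set \<Rightarrow> (real \<Rightarrow> real^3) \<Rightarrow> bool" where
  "line_of_curvature N J \<gamma> \<longleftrightarrow> (\<forall>t\<in>J. \<exists>k.
     ((N \<circ> \<gamma>) has_vector_derivative - (k *\<^sub>R vector_derivative \<gamma> (at t))) (at t))"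

definition principal_chart ::
  "(real^3) set \<Rightarrow> (real^3 \<Rightarrow> real^3) \<Rightarrow> (real \<times> real) set \<Rightarrow> (real \<times> real \<Rightarrow> real^3) \<Rightarrow> bool" where
  "principal_chart M N U X \<longleftrightarrow> chart M U X
     \<and> (\<forall>b. line_of_curvature N {t. (t, b) \<in> U} (\<lambda>t. X (t, b)))
     \<and> (\<forall>a. line_of_curvature N {t. (a, t) \<in> U} (\<lambda>t. X (a, t)))"

text \<open>Spheres and planes are represented by their equations \<open>\<phi> = 0\<close>; contact of order at least
  \<open>n\<close> means that \<open>\<phi>\<close> along the curve vanishes together with its derivatives up to order \<open>n\<close>.\<close>

definition sphere_equation :: "(real^3 \<Rightarrow> real) \<Rightarrow> bool" where
  "sphere_equation \<phi> \<longleftrightarrow> (\<exists>a r. r > 0 \<and> \<phi> = (\<lambda>x. (dist x a)\<^sup>2 - r\<^sup>2))"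

definition plane_equation :: "(real^3 \<Rightarrow> real) \<Rightarrow> bool" where
  "plane_equation \<phi> \<longleftrightarrow> (\<exists>a b. a \<noteq> 0 \<and> \<phi> = (\<lambda>x. a \<bullet> x - b))"

definition contact_at_least :: "nat \<Rightarrow> (real^3 \<Rightarrow> real) \<Rightarrow> (real \<Rightarrow> real^3) \<Rightarrow> real \<Rightarrow> bool" where
  "contact_at_least n \<phi> c s \<longleftrightarrow> (\<forall>k\<le>n. (deriv ^^ k) (\<phi> \<circ> c) s = 0)"

definition osculating_sphere :: "(real^3 \<Rightarrow> real) \<Rightarrow> (real \<Rightarrow> real^3) \<Rightarrow> real \<Rightarrow> bool" where
  "osculating_sphere \<phi> c s \<longleftrightarrow>
     (sphere_equation \<phi> \<or> plane_equation \<phi>) \<and> contact_at_least 3 \<phi> c s"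

text \<open>At degenerate points of the curve (zero curvature, or torsion and derivative of the
  curvature both zero) there may be several osculating spheres or planes; one of them is required
  to be tangent to \<open>M\<close>. This is the reading equivalent to \<open>k\<^sub>n' + \<tau>\<^sub>g k\<^sub>g = 0\<close>.\<close>

definition darboux_curve :: "(real^3) set \<Rightarrow> real set \<Rightarrow> (real \<Rightarrow> real^3) \<Rightarrow> bool" where
  "darboux_curve M J c \<longleftrightarrow> smooth_on J c \<and> c ` J \<subseteq> M
     \<and> (\<forall>s\<in>J. \<exists>\<phi>. osculating_sphere \<phi> c s
          \<and> tangent_space {x. \<phi> x = 0} (c s) = tangent_space M (c s))"

end

theory Submission
  imports Defs
begin

text \<open>Along a curve \<open>c\<close> of unit speed, contact of order 3 with a sphere (or plane) whose normal at
  the contact point is the surface normal \<open>n\<close> makes the third derivative of \<open>c\<close> orthogonal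
  to \<open>n\<close>. On the other hand
  \<open>c'' \<bullet> n = - (c' \<bullet> n') = k1 cos\<^sup>2 \<alpha> + k2 sin\<^sup>2 \<alpha>\<close>, so differentiating gives
  \<open>(k1 cos\<^sup>2 \<alpha> + k2 sin\<^sup>2 \<alpha>)' = c'' \<bullet> n'\<close>, where \<open>n' = - k1 u' X\<^sub>u - k2 v' X\<^sub>v\<close>. The tangential
  components of \<open>c''\<close> come from differentiating \<open>c' \<bullet> X\<^sub>u = \<surd>E cos \<alpha>\<close> and
  \<open>c' \<bullet> X\<^sub>v = \<surd>G sin \<alpha>\<close>; their Christoffel terms cancel against \<open>\<partial>k1/\<partial>v\<close> and \<open>\<partial>k2/\<partial>u\<close> by the
  Codazzi equations, which express \<open>N\<^sub>u\<^sub>v = N\<^sub>v\<^sub>u\<close>.\<close>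

section \<open>Smooth maps on open sets\<close>

text \<open>A derivative taken at a point of the open set \<open>S\<close> depends only on values in
  \<open>S\<close>. The recursion passes from functions to their directional derivatives, so the
  induction varies both \<open>f\<close> and \<open>g\<close>.\<close>

lemma C_k_on_cong:
  assumes "open S" and "\<And>x. x \<in> S \<Longrightarrow> f x = g x" and "C_k_on k S f"
  shows "C_k_on k S g"
  using assms(2,3)
proof (induction k arbitrary: f g)
  case 0
  then show ?case by (simp cong: continuous_on_cong)
next
  case (Suc k)
  have der: "(g has_derivative frechet_derivative f (at x)) (at x)" if "x \<in> S" for x
  proof -
    have "(f has_derivative frechet_derivative f (at x)) (at x)"
      using Suc.prems(2) that by (simp add: frechet_derivative_works [symmetric])
    from has_derivative_transform_within_open [OF this \<open>open S\<close> that Suc.prems(1)]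
    show ?thesis by blast
  qed
  have "C_k_on k S (\<lambda>x. frechet_derivative g (at x) h)" for h
  proof (rule Suc.IH [of "\<lambda>x. frechet_derivative f (at x) h"])
    show "C_k_on k S (\<lambda>x. frechet_derivative f (at x) h)" using Suc.prems(2) by simp
  next
    fix x assume "x \<in> S"
    then show "frechet_derivative f (at x) h = frechet_derivative g (at x) h"
      using frechet_derivative_at [OF der] by simp
  qed
  with der show ?case by (auto simp: differentiable_def)
qed

lemma smooth_on_cong:
  assumes "open S" and "\<And>x. x \<in> S \<Longrightarrow> f x = g x" and "smooth_on S f"
  shows "smooth_on S g"
  using assms C_k_on_cong unfolding smooth_on_def by blast

lemma smooth_on_differentiable:
  assumes "smooth_on S f" and "x \<in> S"
  shows "f differentiable (at x)"
proof -
  have "C_k_on (Suc 0) S f" using assms(1) unfolding smooth_on_def by blast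
  with assms(2) show ?thesis by simp
qed

lemma smooth_on_frechet_derivative:
  assumes "smooth_on S f"
  shows "smooth_on S (\<lambda>x. frechet_derivative f (at x) h)"
  unfolding smooth_on_def
proof
  fix k
  have "C_k_on (Suc k) S f" using assms unfolding smooth_on_def by blast
  then show "C_k_on k S (\<lambda>x. frechet_derivative f (at x) h)" by simp
qed

lemma smooth_on_continuous_on:
  "smooth_on S f \<Longrightarrow> continuous_on S f"
  unfolding smooth_on_def by (metis C_k_on.simps(1))

text \<open>This special case replaces a chain rule for general maps: the derivative along the line
  is a directional derivative of \<open>f\<close> composed with the same line, so the induction over
  all \<open>f\<close> applies to it again.\<close>

lemma C_k_on_line:
  fixes f :: "'a::euclidean_space \<Rightarrow> 'b::real_normed_vector"
  assumes "open T" and "\<And>t::real. t \<in> T \<Longrightarrow> p + t *\<^sub>R h \<in> S" and "C_k_on k S f"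
  shows "C_k_on k T (\<lambda>t. f (p + t *\<^sub>R h))"
  using assms(3)
proof (induction k arbitrary: f)
  case 0
  have "continuous_on T (\<lambda>t. p + t *\<^sub>R h)" by (intro continuous_intros)
  moreover have "(\<lambda>t. p + t *\<^sub>R h) ` T \<subseteq> S" using assms(2) by auto
  ultimately show ?case
    using 0 continuous_on_compose2 [of S f T "\<lambda>t. p + t *\<^sub>R h"] by simp
next
  case (Suc k)
  have der: "((\<lambda>t. f (p + t *\<^sub>R h)) has_derivative
      (\<lambda>\<tau>. frechet_derivative f (at (p + t *\<^sub>R h)) (\<tau> *\<^sub>R h))) (at t)" if "t \<in> T" for t
  proof -
    have "(f has_derivative frechet_derivative f (at (p + t *\<^sub>R h))) (at (p + t *\<^sub>R h))"
      using Suc.prems assms(2) [OF that] by (simp add: frechet_derivative_works [symmetric])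
    moreover have "((\<lambda>t. p + t *\<^sub>R h) has_derivative (\<lambda>\<tau>. \<tau> *\<^sub>R h)) (at t)"
      by (auto intro!: derivative_eq_intros)
    ultimately show ?thesis
      using diff_chain_at [of "\<lambda>t. p + t *\<^sub>R h" "\<lambda>\<tau>. \<tau> *\<^sub>R h" t f] by (simp add: o_def)
  qed
  have "C_k_on k T (\<lambda>t. frechet_derivative (\<lambda>t. f (p + t *\<^sub>R h)) (at t) \<tau>)" for \<tau>
  proof (rule C_k_on_cong [OF \<open>open T\<close>])
    show "C_k_on k T (\<lambda>t. frechet_derivative f (at (p + t *\<^sub>R h)) (\<tau> *\<^sub>R h))"
      using Suc.prems by (intro Suc.IH) simp
  next
    fix t assume "t \<in> T"
    from frechet_derivative_at [OF der [OF this]]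
    show "frechet_derivative f (at (p + t *\<^sub>R h)) (\<tau> *\<^sub>R h)
        = frechet_derivative (\<lambda>t. f (p + t *\<^sub>R h)) (at t) \<tau>"
      by metis
  qed
  with der show ?case by (auto simp: differentiable_def)
qed

lemma smooth_on_line:
  assumes "open T" and "\<And>t::real. t \<in> T \<Longrightarrow> p + t *\<^sub>R h \<in> S" and "smooth_on S f"
  shows "smooth_on T (\<lambda>t. f (p + t *\<^sub>R h))"
  using assms C_k_on_line unfolding smooth_on_def by blast

lemma smooth_on_has_vector_derivative:
  fixes c :: "real \<Rightarrow> 'b::real_normed_vector"
  assumes "smooth_on S c" and "open S"
  shows "\<And>s. s \<in> S \<Longrightarrow> (c has_vector_derivative vector_derivative c (at s)) (at s)"
    and "smooth_on S (\<lambda>s. vector_derivative c (at s))"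
proof -
  show *: "(c has_vector_derivative vector_derivative c (at s)) (at s)" if "s \<in> S" for s
    using smooth_on_differentiable [OF assms(1) that] by (simp add: vector_derivative_works)
  show "smooth_on S (\<lambda>s. vector_derivative c (at s))"
  proof (rule smooth_on_cong [OF \<open>open S\<close> _ smooth_on_frechet_derivative [OF assms(1), of 1]])
    fix s assume "s \<in> S"
    from frechet_derivative_at [OF * [OF this, unfolded has_vector_derivative_def]]
    show "frechet_derivative c (at s) 1 = vector_derivative c (at s)" by (metis scaleR_one)
  qed
qed

section \<open>Partial derivatives and the chain rule\<close>

text \<open>\<open>d_u\<close> and \<open>d_v\<close> are a \<open>vector_derivative\<close> of
  slices, which says nothing when a slice is not differentiable. Total differentiability identifies
  them with the images of the basis vectors, so later computations can use
  \<open>has_derivative\<close>.\<close>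

lemma has_derivative_d_u_d_v:
  assumes "f differentiable (at p)"
  shows "(f has_derivative (\<lambda>h. fst h *\<^sub>R d_u f p + snd h *\<^sub>R d_v f p)) (at p)"
    and "((\<lambda>t. f (t, snd p)) has_vector_derivative d_u f p) (at (fst p))"
    and "((\<lambda>t. f (fst p, t)) has_vector_derivative d_v f p) (at (snd p))"
    and "frechet_derivative f (at p) h = fst h *\<^sub>R d_u f p + snd h *\<^sub>R d_v f p"
proof -
  define D where "D = frechet_derivative f (at p)"
  have D: "(f has_derivative D) (at p)"
    using assms unfolding D_def by (simp add: frechet_derivative_works [symmetric])
  have lin: "linear D" using D has_derivative_linear by blast
  have u: "((\<lambda>t. f (t, snd p)) has_vector_derivative D (1, 0)) (at (fst p))"
  proof -
    have "((\<lambda>t. (t, snd p)) has_derivative (\<lambda>t. (t, 0))) (at (fst p))"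
      by (auto intro!: derivative_eq_intros)
    moreover have "(f has_derivative D) (at ((\<lambda>t. (t, snd p)) (fst p)))" using D by simp
    ultimately have "((f \<circ> (\<lambda>t. (t, snd p))) has_derivative D \<circ> (\<lambda>t. (t, 0))) (at (fst p))"
      by (rule diff_chain_at)
    moreover have "D \<circ> (\<lambda>t. (t, 0)) = (\<lambda>t. t *\<^sub>R D (1, 0))"
      by (simp add: fun_eq_iff linear_scale [OF lin, symmetric])
    ultimately show ?thesis unfolding has_vector_derivative_def by (simp add: o_def)
  qed
  have v: "((\<lambda>t. f (fst p, t)) has_vector_derivative D (0, 1)) (at (snd p))"
  proof -
    have "((\<lambda>t. (fst p, t)) has_derivative (\<lambda>t. (0, t))) (at (snd p))"
      by (auto intro!: derivative_eq_intros)
    moreover have "(f has_derivative D) (at ((\<lambda>t. (fst p, t)) (snd p)))" using D by simp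
    ultimately have "((f \<circ> (\<lambda>t. (fst p, t))) has_derivative D \<circ> (\<lambda>t. (0, t))) (at (snd p))"
      by (rule diff_chain_at)
    moreover have "D \<circ> (\<lambda>t. (0, t)) = (\<lambda>t. t *\<^sub>R D (0, 1))"
      by (simp add: fun_eq_iff linear_scale [OF lin, symmetric])
    ultimately show ?thesis unfolding has_vector_derivative_def by (simp add: o_def)
  qed
  have uD: "d_u f p = D (1, 0)" and vD: "d_v f p = D (0, 1)"
    using vector_derivative_at [OF u] vector_derivative_at [OF v] by (simp_all add: d_u_def d_v_def)
  have eq: "D h = fst h *\<^sub>R d_u f p + snd h *\<^sub>R d_v f p" for h
    by (simp add: uD vD linear_add [OF lin, symmetric] linear_scale [OF lin, symmetric])
  show "(f has_derivative (\<lambda>h. fst h *\<^sub>R d_u f p + snd h *\<^sub>R d_v f p)) (at p)"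
    using D eq by (metis (no_types, lifting) ext)
  show "((\<lambda>t. f (t, snd p)) has_vector_derivative d_u f p) (at (fst p))"
    and "((\<lambda>t. f (fst p, t)) has_vector_derivative d_v f p) (at (snd p))"
    using u v uD vD by simp_all
  show "frechet_derivative f (at p) h = fst h *\<^sub>R d_u f p + snd h *\<^sub>R d_v f p"
    using eq D_def by simp
qed

lemma smooth_on_partial_derivatives:
  assumes "open U" and "smooth_on U f"
  shows "smooth_on U (d_u f)" and "smooth_on U (d_v f)"
proof -
  show "smooth_on U (d_u f)"
    by (rule smooth_on_cong [OF assms(1) _ smooth_on_frechet_derivative [OF assms(2), of "(1, 0)"]])
       (simp add: has_derivative_d_u_d_v(4) [OF smooth_on_differentiable [OF assms(2)]])
  show "smooth_on U (d_v f)"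
    by (rule smooth_on_cong [OF assms(1) _ smooth_on_frechet_derivative [OF assms(2), of "(0, 1)"]])
       (simp add: has_derivative_d_u_d_v(4) [OF smooth_on_differentiable [OF assms(2)]])
qed

lemma has_vector_derivative_along_curve:
  assumes "f differentiable (at (u s, v s))"
    and "(u has_real_derivative u') (at s)" and "(v has_real_derivative v') (at s)"
  shows "((\<lambda>t. f (u t, v t)) has_vector_derivative
    u' *\<^sub>R d_u f (u s, v s) + v' *\<^sub>R d_v f (u s, v s)) (at s)"
proof -
  have "((\<lambda>t. (u t, v t)) has_derivative (\<lambda>h. (h *\<^sub>R u', h *\<^sub>R v'))) (at s)"
    using assms(2,3) unfolding has_field_derivative_def
    by (auto intro!: derivative_eq_intros simp: mult.commute)
  from diff_chain_at [OF this has_derivative_d_u_d_v(1) [OF assms(1)]]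
  show ?thesis
    unfolding has_vector_derivative_def by (simp add: o_def scaleR_add_right)
qed

section \<open>Symmetry of mixed second partial derivatives\<close>

text \<open>The second difference is the increment of
  \<open>\<lambda>x. f x (b + h) - f x b\<close>, so the mean value theorem applies first in
  \<open>x\<close> and then, to \<open>fx x\<close>, in \<open>y\<close>.\<close>

lemma second_difference_mean_value:
  fixes f fx fxy :: "real \<Rightarrow> real \<Rightarrow> real"
  assumes "h > 0"
    and fx: "\<And>x y. \<lbrakk>x \<in> {a..a + h}; y \<in> {b..b + h}\<rbrakk> \<Longrightarrow>
      ((\<lambda>x. f x y) has_real_derivative fx x y) (at x)"
    and fxy: "\<And>x y. \<lbrakk>x \<in> {a..a + h}; y \<in> {b..b + h}\<rbrakk> \<Longrightarrow>
      (fx x has_real_derivative fxy x y) (at y)"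
  obtains x y where "x \<in> {a..a + h}" and "y \<in> {b..b + h}"
    and "f (a + h) (b + h) - f (a + h) b - f a (b + h) + f a b = h * h * fxy x y"
proof -
  have "\<exists>x>a. x < a + h \<and> (f (a + h) (b + h) - f (a + h) b) - (f a (b + h) - f a b)
      = (a + h - a) * (fx x (b + h) - fx x b)"
    using \<open>h > 0\<close> by (intro MVT2 DERIV_diff fx) auto
  then obtain x where x: "a < x" "x < a + h"
      and 1: "(f (a + h) (b + h) - f (a + h) b) - (f a (b + h) - f a b)
        = h * (fx x (b + h) - fx x b)"
    by auto
  have "\<exists>y>b. y < b + h \<and> fx x (b + h) - fx x b = (b + h - b) * fxy x y"
    using \<open>h > 0\<close> x by (intro MVT2 fxy) auto
  then obtain y where y: "b < y" "y < b + h" and 2: "fx x (b + h) - fx x b = h * fxy x y"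
    by auto
  show thesis
    using that [of x y] x y 1 2 by (simp add: algebra_simps)
qed

text \<open>Over a small square one second difference equals \<open>h * h\<close> times a value of
  either mixed partial, depending on which variable is treated first; continuity carries the
  agreement to \<open>p\<close>. Pairing with \<open>w\<close> gives the real-valued functions that
  the mean value theorem requires.\<close>

lemma smooth_on_mixed_partials_eq:
  fixes f :: "real \<times> real \<Rightarrow> 'b::real_inner"
  assumes "open U" and "smooth_on U f" and "p \<in> U"
  shows "d_v (d_u f) p = d_u (d_v f) p"
proof -
  obtain a b where p: "p = (a, b)" by fastforce
  have "d_v (d_u f) p \<bullet> w = d_u (d_v f) p \<bullet> w" for w
  proof (rule ccontr)
    define P where "P = (\<lambda>q. d_v (d_u f) q \<bullet> w)"
    define Q where "Q = (\<lambda>q. d_u (d_v f) q \<bullet> w)"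
    \<comment> \<open>Half the gap: a number closer than \<open>\<epsilon>\<close> to
      \<open>P p\<close> cannot be closer than \<open>\<epsilon>\<close> to
      \<open>Q p\<close>.\<close>
    define \<epsilon> where "\<epsilon> = \<bar>P p - Q p\<bar> / 2"
    assume "d_v (d_u f) p \<bullet> w \<noteq> d_u (d_v f) p \<bullet> w"
    then have "\<epsilon> > 0" by (simp add: \<epsilon>_def P_def Q_def)
    note sm = smooth_on_partial_derivatives [OF \<open>open U\<close>]
    have cont: "continuous_on U P" "continuous_on U Q"
      unfolding P_def Q_def
      by (intro continuous_intros smooth_on_continuous_on sm assms(2))+
    then have "isCont P p" "isCont Q p"
      using continuous_on_eq_continuous_at \<open>open U\<close> \<open>p \<in> U\<close> by blast+
    then have "\<forall>\<^sub>F q in nhds p. dist (P q) (P p) < \<epsilon> \<and> dist (Q q) (Q p) < \<epsilon> \<and> q \<in> U"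
      using \<open>\<epsilon> > 0\<close> \<open>open U\<close> \<open>p \<in> U\<close>
      by (intro eventually_conj tendstoD eventually_nhds_in_open)
         (auto simp: isCont_def tendsto_at_iff_tendsto_nhds)
    then obtain \<delta> where "\<delta> > 0" and \<delta>: "\<And>q. dist q p < \<delta> \<Longrightarrow>
        dist (P q) (P p) < \<epsilon> \<and> dist (Q q) (Q p) < \<epsilon> \<and> q \<in> U"
      unfolding eventually_nhds_metric by blast
    \<comment> \<open>Two sides of length \<open>\<delta> / 3\<close> add up to less than
      \<open>\<delta>\<close>, so the whole square lies in the ball around \<open>p\<close>.\<close>
    define h where "h = \<delta> / 3"
    have "h > 0" using \<open>\<delta> > 0\<close> by (simp add: h_def)
    have near: "dist (x, y) p < \<delta>" if "x \<in> {a..a + h}" "y \<in> {b..b + h}" for x y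
    proof -
      have "dist (x, y) p \<le> \<bar>x - a\<bar> + \<bar>y - b\<bar>"
        unfolding p dist_prod_def fst_conv snd_conv
        by (metis dist_real_def sqrt_sum_squares_le_sum_abs power2_abs)
      also have "\<dots> < \<delta>" using that \<open>\<delta> > 0\<close> by (auto simp: h_def)
      finally show ?thesis .
    qed
    have dif: "f differentiable (at q)" "d_u f differentiable (at q)" "d_v f differentiable (at q)"
      if "q \<in> U" for q
      using smooth_on_differentiable sm assms(2) that by blast+
    have U: "(x, y) \<in> U" if "x \<in> {a..a + h}" "y \<in> {b..b + h}" for x y
      using \<delta> near that by blast
    have inn: "((\<lambda>t. g t \<bullet> w) has_real_derivative g' \<bullet> w) (at t)"
      if "(g has_vector_derivative g') (at t)" for g g' and t :: real
      using that unfolding has_vector_derivative_def has_field_derivative_def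
      by (auto intro!: derivative_eq_intros simp: mult.commute)
    have "((\<lambda>x. f (x, y) \<bullet> w) has_real_derivative d_u f (x, y) \<bullet> w) (at x)"
      "((\<lambda>y. d_u f (x, y) \<bullet> w) has_real_derivative P (x, y)) (at y)"
      "((\<lambda>y. f (x, y) \<bullet> w) has_real_derivative d_v f (x, y) \<bullet> w) (at y)"
      "((\<lambda>x. d_v f (x, y) \<bullet> w) has_real_derivative Q (x, y)) (at x)"
      if "x \<in> {a..a + h}" "y \<in> {b..b + h}" for x y
      using has_derivative_d_u_d_v(2,3) [OF dif(1) [OF U [OF that]]]
        has_derivative_d_u_d_v(3) [OF dif(2) [OF U [OF that]]]
        has_derivative_d_u_d_v(2) [OF dif(3) [OF U [OF that]]]
      unfolding P_def Q_def by (auto intro: inn)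
    note der = this
    obtain x y where xy: "x \<in> {a..a + h}" "y \<in> {b..b + h}"
      and 1: "f (a + h, b + h) \<bullet> w - f (a + h, b) \<bullet> w - f (a, b + h) \<bullet> w + f (a, b) \<bullet> w
        = h * h * P (x, y)"
      by (rule second_difference_mean_value [of h a b "\<lambda>x y. f (x, y) \<bullet> w"
            "\<lambda>x y. d_u f (x, y) \<bullet> w" "\<lambda>x y. P (x, y)"]) (use \<open>h > 0\<close> der in auto)
    \<comment> \<open>Exchanging the roles of the variables only permutes the terms of the second
      difference.\<close>
    obtain y' x' where xy': "x' \<in> {a..a + h}" "y' \<in> {b..b + h}"
      and 2: "f (a + h, b + h) \<bullet> w - f (a, b + h) \<bullet> w - f (a + h, b) \<bullet> w + f (a, b) \<bullet> w
        = h * h * Q (x', y')"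
      by (rule second_difference_mean_value [of h b a "\<lambda>y x. f (x, y) \<bullet> w"
            "\<lambda>y x. d_v f (x, y) \<bullet> w" "\<lambda>y x. Q (x, y)"]) (use \<open>h > 0\<close> der in auto)
    have "h * h * P (x, y) = h * h * Q (x', y')" using 1 2 by linarith
    then have "P (x, y) = Q (x', y')" using \<open>h > 0\<close> by simp
    moreover have "dist (P (x, y)) (P p) < \<epsilon>" "dist (Q (x', y')) (Q p) < \<epsilon>"
      using \<delta> near xy xy' by blast+
    ultimately show False
      unfolding \<epsilon>_def dist_real_def by (simp add: abs_if split: if_splits)
  qed
  then show ?thesis using vector_eq_rdot by blast
qed

section \<open>Differentiation rules for partial derivatives\<close>

lemma d_u_d_v_eqI:
  assumes "(f has_derivative D) (at p)"
  shows "d_u f p = D (1, 0)" and "d_v f p = D (0, 1)"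
proof -
  have dif: "f differentiable (at p)" using assms by (auto simp: differentiable_def)
  have "D h = fst h *\<^sub>R d_u f p + snd h *\<^sub>R d_v f p" for h
    using has_derivative_d_u_d_v(4) [OF dif] frechet_derivative_at [OF assms] by simp
  from this [of "(1, 0)"] this [of "(0, 1)"]
  show "d_u f p = D (1, 0)" and "d_v f p = D (0, 1)" by simp_all
qed

lemma d_u_d_v_cong:
  assumes "open U" and "p \<in> U" and "\<And>q. q \<in> U \<Longrightarrow> f q = g q" and "f differentiable (at p)"
  shows "d_u g p = d_u f p" and "d_v g p = d_v f p"
proof -
  have "(g has_derivative (\<lambda>h. fst h *\<^sub>R d_u f p + snd h *\<^sub>R d_v f p)) (at p)"
    using has_derivative_d_u_d_v(1) [OF assms(4)] assms(1-3)
    by (rule has_derivative_transform_within_open)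
  from d_u_d_v_eqI [OF this] show "d_u g p = d_u f p" and "d_v g p = d_v f p" by simp_all
qed

lemma d_u_d_v_inner:
  fixes f g :: "real \<times> real \<Rightarrow> 'b::real_inner"
  assumes "f differentiable (at p)" and "g differentiable (at p)"
  shows "d_u (\<lambda>q. f q \<bullet> g q) p = d_u f p \<bullet> g p + f p \<bullet> d_u g p"
    and "d_v (\<lambda>q. f q \<bullet> g q) p = d_v f p \<bullet> g p + f p \<bullet> d_v g p"
proof -
  note * = has_derivative_inner
    [OF has_derivative_d_u_d_v(1) [OF assms(1)] has_derivative_d_u_d_v(1) [OF assms(2)]]
  show "d_u (\<lambda>q. f q \<bullet> g q) p = d_u f p \<bullet> g p + f p \<bullet> d_u g p"
    and "d_v (\<lambda>q. f q \<bullet> g q) p = d_v f p \<bullet> g p + f p \<bullet> d_v g p"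
    using d_u_d_v_eqI [OF *] by simp_all
qed

lemma d_u_d_v_scaleR:
  fixes k :: "real \<times> real \<Rightarrow> real"
  assumes "k differentiable (at p)" and "f differentiable (at p)"
  shows "d_u (\<lambda>q. k q *\<^sub>R f q) p = d_u k p *\<^sub>R f p + k p *\<^sub>R d_u f p"
    and "d_v (\<lambda>q. k q *\<^sub>R f q) p = d_v k p *\<^sub>R f p + k p *\<^sub>R d_v f p"
proof -
  note * = has_derivative_scaleR
    [OF has_derivative_d_u_d_v(1) [OF assms(1)] has_derivative_d_u_d_v(1) [OF assms(2)]]
  show "d_u (\<lambda>q. k q *\<^sub>R f q) p = d_u k p *\<^sub>R f p + k p *\<^sub>R d_u f p"
    and "d_v (\<lambda>q. k q *\<^sub>R f q) p = d_v k p *\<^sub>R f p + k p *\<^sub>R d_v f p"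
    using d_u_d_v_eqI [OF *] by simp_all
qed

text \<open>Moves a derivative from one factor to the other. It serves for the identities X_u . N =
  0, X_v . N = 0 and X_u . X_v = 0.\<close>

lemma inner_eq_zero_on_open:
  fixes f g :: "real \<times> real \<Rightarrow> 'b::real_inner"
  assumes "open U" and "p \<in> U" and "\<And>q. q \<in> U \<Longrightarrow> f q \<bullet> g q = 0"
    and "f differentiable (at p)" and "g differentiable (at p)"
  shows "d_u f p \<bullet> g p = - (f p \<bullet> d_u g p)" and "d_v f p \<bullet> g p = - (f p \<bullet> d_v g p)"
proof -
  have "((\<lambda>q. f q \<bullet> g q) has_derivative (\<lambda>_. 0)) (at p)"
    by (rule has_derivative_transform_within_open [OF has_derivative_const [of 0] assms(1,2)])
       (simp add: assms(3))
  from d_u_d_v_eqI [OF this]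
  show "d_u f p \<bullet> g p = - (f p \<bullet> d_u g p)" and "d_v f p \<bullet> g p = - (f p \<bullet> d_v g p)"
    using d_u_d_v_inner [OF assms(4,5)] by simp_all
qed

section \<open>Tangent spaces of charts and of level sets\<close>

text \<open>The curve witnessing tangency is the image under \<open>X\<close> of a segment through
  \<open>p\<close> in direction \<open>h\<close>, short enough to stay in the open set
  \<open>U\<close>.\<close>

lemma frechet_derivative_in_tangent_space:
  assumes "chart M U X" and "p \<in> U"
  shows "frechet_derivative X (at p) h \<in> tangent_space M (X p)"
proof -
  have U: "open U" and X: "smooth_on U X" and XM: "X ` U \<subseteq> M"
    using assms(1) openin_imp_subset unfolding chart_def by blast+
  define T where "T = (\<lambda>t::real. p + t *\<^sub>R h) -` U"
  have "open T" unfolding T_def by (intro open_vimage continuous_intros U)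
  moreover have "0 \<in> T" using assms(2) by (simp add: T_def)
  ultimately obtain \<epsilon> where "\<epsilon> > 0" and \<epsilon>: "\<And>t. \<bar>t\<bar> < \<epsilon> \<Longrightarrow> t \<in> T"
    unfolding open_dist dist_real_def by (metis diff_zero)
  let ?\<gamma> = "\<lambda>t. X (p + t *\<^sub>R h)"
  have in_U: "p + t *\<^sub>R h \<in> U" if "t \<in> {-\<epsilon><..<\<epsilon>}" for t
  proof -
    have "\<bar>t\<bar> < \<epsilon>" using that by auto
    from \<epsilon> [OF this] show ?thesis by (simp add: T_def)
  qed
  have "smooth_on {-\<epsilon><..<\<epsilon>} ?\<gamma>"
    using in_U X by (intro smooth_on_line [where S = U]) auto
  moreover have "?\<gamma> ` {-\<epsilon><..<\<epsilon>} \<subseteq> M" using in_U XM by blast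
  moreover have "(?\<gamma> has_vector_derivative frechet_derivative X (at p) h) (at 0)"
  proof -
    have D: "(X has_derivative frechet_derivative X (at p)) (at p)"
      using smooth_on_differentiable [OF X assms(2)] by (simp add: frechet_derivative_works [symmetric])
    have "((\<lambda>t. p + t *\<^sub>R h) has_derivative (\<lambda>t. t *\<^sub>R h)) (at (0::real))"
      by (auto intro!: derivative_eq_intros)
    moreover have "(X has_derivative frechet_derivative X (at p)) (at (p + 0 *\<^sub>R h))" using D by simp
    ultimately have "(X \<circ> (\<lambda>t. p + t *\<^sub>R h) has_derivative
        frechet_derivative X (at p) \<circ> (\<lambda>t. t *\<^sub>R h)) (at 0)"
      by (rule diff_chain_at)
    then show ?thesis
      using linear_scale [OF has_derivative_linear [OF D]]
      unfolding has_vector_derivative_def by (simp add: o_def)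
  qed
  ultimately show ?thesis
    unfolding tangent_space_def using \<open>\<epsilon> > 0\<close> by (auto intro!: exI [of _ ?\<gamma>] exI [of _ \<epsilon>])
qed

lemma chart_d_u_d_v:
  assumes "chart M U X" and "p \<in> U"
  shows "d_u X p \<in> tangent_space M (X p)" and "d_v X p \<in> tangent_space M (X p)"
    and "d_u X p \<noteq> 0" and "d_v X p \<noteq> 0"
proof -
  have dif: "X differentiable (at p)" and inj: "inj (frechet_derivative X (at p))"
    using assms smooth_on_differentiable unfolding chart_def by blast+
  note eq = has_derivative_d_u_d_v(4) [OF dif]
  show "d_u X p \<in> tangent_space M (X p)" "d_v X p \<in> tangent_space M (X p)"
    using frechet_derivative_in_tangent_space [OF assms, of "(1, 0)"]
      frechet_derivative_in_tangent_space [OF assms, of "(0, 1)"] by (simp_all add: eq)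
  show "d_u X p \<noteq> 0" "d_v X p \<noteq> 0"
    using injD [OF inj, of "(1, 0)" 0] injD [OF inj, of "(0, 1)" 0]
    by (auto simp: eq zero_prod_def)
qed

text \<open>Along a curve in the zero set \<open>\<phi>\<close> is constantly zero, so the chain
  rule at 0 gives the claim.\<close>

lemma tangent_space_level_set:
  assumes "(\<phi> has_derivative \<phi>') (at p)" and "w \<in> tangent_space {x. \<phi> x = 0} p"
  shows "\<phi>' w = 0"
proof -
  obtain \<gamma> \<epsilon> where "\<epsilon> > 0" and \<gamma>: "\<gamma> ` {-\<epsilon><..<\<epsilon>} \<subseteq> {x. \<phi> x = 0}" "\<gamma> 0 = p"
      "(\<gamma> has_vector_derivative w) (at (0::real))"
    using assms(2) unfolding tangent_space_def by blast
  have "((\<phi> \<circ> \<gamma>) has_derivative \<phi>' \<circ> (\<lambda>t. t *\<^sub>R w)) (at 0)"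
    using \<gamma>(2,3) assms(1) unfolding has_vector_derivative_def by (intro diff_chain_at) auto
  moreover have "((\<phi> \<circ> \<gamma>) has_derivative (\<lambda>t. 0)) (at 0)"
    by (rule has_derivative_transform_within_open [OF has_derivative_const [of 0],
          where s = "{-\<epsilon><..<\<epsilon>}"]) (use \<open>\<epsilon> > 0\<close> \<gamma>(1) in \<open>auto simp: image_subset_iff\<close>)
  ultimately have "\<phi>' \<circ> (\<lambda>t. t *\<^sub>R w) = (\<lambda>t. 0)" by (rule has_derivative_unique)
  from fun_cong [OF this, of 1] show ?thesis by simp
qed

section \<open>Contact with spheres and planes\<close>

text \<open>Links the iterated \<open>deriv\<close> of \<open>contact_at_least\<close> to explicit
  derivatives. The first two are given on the whole neighbourhood \<open>J\<close>, since each must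
  be differentiated once more; the last is given at \<open>s\<close> alone.\<close>

lemma deriv_3_eqI:
  fixes f :: "real \<Rightarrow> real"
  assumes "open J" and "s \<in> J"
    and f: "\<And>t. t \<in> J \<Longrightarrow> (f has_real_derivative f1 t) (at t)"
    and f1: "\<And>t. t \<in> J \<Longrightarrow> (f1 has_real_derivative f2 t) (at t)"
    and f2: "(f2 has_real_derivative D) (at s)"
  shows "(deriv ^^ 3) f s = D"
proof -
  have d1: "f1 t = deriv f t" if "t \<in> J" for t using f that DERIV_imp_deriv by metis
  have d2: "f2 t = deriv (deriv f) t" if "t \<in> J" for t
    using has_field_derivative_transform_within_open [OF f1 [OF that] \<open>open J\<close> that d1]
      DERIV_imp_deriv by metis
  have "deriv (deriv (deriv f)) s = D"
    using has_field_derivative_transform_within_open [OF f2 \<open>open J\<close> \<open>s \<in> J\<close> d2]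
      DERIV_imp_deriv by metis
  then show ?thesis by (simp add: numeral_3_eq_3)
qed

lemma has_real_derivative_inner:
  fixes f g :: "real \<Rightarrow> 'b::real_inner"
  assumes "(f has_vector_derivative f') (at s)" and "(g has_vector_derivative g') (at s)"
  shows "((\<lambda>t. f t \<bullet> g t) has_real_derivative f' \<bullet> g s + f s \<bullet> g') (at s)"
  using has_derivative_inner [OF assms [unfolded has_vector_derivative_def]]
  unfolding has_field_derivative_def by (rule has_derivative_eq_rhs) (auto simp: algebra_simps)

text \<open>For a sphere with centre \<open>a\<close> the third derivative of \<open>(dist (c t) a)\<^sup>2\<close> reduces to
  \<open>2 (c - a) \<bullet> c3\<close>, because \<open>c1 \<bullet> c2 = 0\<close> for a curve of unit speed.\<close>

lemma osculating_sphere_conormal: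
  assumes osc: "osculating_sphere \<phi> c s" and J: "open J" "s \<in> J"
    and c1: "\<And>t. t \<in> J \<Longrightarrow> (c has_vector_derivative c1 t) (at t)"
    and c2: "\<And>t. t \<in> J \<Longrightarrow> (c1 has_vector_derivative c2 t) (at t)"
    and c3: "\<And>t. t \<in> J \<Longrightarrow> (c2 has_vector_derivative c3 t) (at t)"
    and unit: "\<And>t. t \<in> J \<Longrightarrow> norm (c1 t) = 1"
  obtains m where "m \<noteq> 0" and "m \<bullet> c3 s = 0"
    and "\<And>w. w \<in> tangent_space {x. \<phi> x = 0} (c s) \<Longrightarrow> m \<bullet> w = 0"
proof -
  have contact: "\<forall>k\<le>3. (deriv ^^ k) (\<phi> \<circ> c) s = 0" and "sphere_equation \<phi> \<or> plane_equation \<phi>"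
    using osc unfolding osculating_sphere_def contact_at_least_def by auto
  have zero: "\<phi> (c s) = 0" and third: "(deriv ^^ 3) (\<phi> \<circ> c) s = 0"
    using contact [rule_format, of 0] contact [rule_format, of 3] by simp_all
  have c1c1: "c1 t \<bullet> c1 t = 1" if "t \<in> J" for t
    using unit [OF that] by (simp add: norm_eq_1)
  have c1c2: "c1 t \<bullet> c2 t = 0" if "t \<in> J" for t
  proof -
    have "((\<lambda>t. c1 t \<bullet> c1 t) has_real_derivative c2 t \<bullet> c1 t + c1 t \<bullet> c2 t) (at t)"
      by (intro has_real_derivative_inner c2 that)
    moreover have "((\<lambda>t. c1 t \<bullet> c1 t) has_real_derivative 0) (at t)"
      by (rule has_field_derivative_transform_within_open [OF DERIV_const [of 1] J(1) that])
         (simp add: c1c1)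
    ultimately have "c2 t \<bullet> c1 t + c1 t \<bullet> c2 t = 0" by (rule DERIV_unique)
    then show ?thesis by (simp add: inner_commute)
  qed
  from \<open>sphere_equation \<phi> \<or> plane_equation \<phi>\<close> show thesis
  proof
    assume "sphere_equation \<phi>"
    then obtain a r where "r > 0" and \<phi>: "\<phi> = (\<lambda>x. (dist x a)\<^sup>2 - r\<^sup>2)"
      unfolding sphere_equation_def by blast
    have \<phi>': "\<phi> = (\<lambda>x. (x - a) \<bullet> (x - a) - r\<^sup>2)"
      unfolding \<phi> by (simp add: dist_norm power2_norm_eq_inner)
    have ca: "((\<lambda>t. c t - a) has_vector_derivative c1 t) (at t)" if "t \<in> J" for t
      using c1 [OF that] by (auto intro!: derivative_eq_intros)
    have "(deriv ^^ 3) (\<phi> \<circ> c) s = 2 * ((c s - a) \<bullet> c3 s)"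
    proof (rule deriv_3_eqI [OF J])
      fix t assume t: "t \<in> J"
      show "((\<phi> \<circ> c) has_real_derivative 2 * ((c t - a) \<bullet> c1 t)) (at t)"
        using DERIV_diff [OF has_real_derivative_inner [OF ca [OF t] ca [OF t]] DERIV_const [of "r\<^sup>2"]]
        unfolding \<phi>' by (simp add: o_def inner_commute)
      have "((\<lambda>t. 2 * ((c t - a) \<bullet> c1 t)) has_real_derivative
          2 * (c1 t \<bullet> c1 t + (c t - a) \<bullet> c2 t)) (at t)"
        by (intro DERIV_cmult has_real_derivative_inner ca c2 t)
      \<comment> \<open>With \<open>c1 t \<bullet> c1 t\<close> replaced by the constant 1, the next
        derivative comes from the other product alone.\<close>
      then show "((\<lambda>t. 2 * ((c t - a) \<bullet> c1 t)) has_real_derivative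
          2 * (1 + (c t - a) \<bullet> c2 t)) (at t)"
        by (simp add: c1c1 [OF t])
    next
      have "((\<lambda>t. 2 * (1 + (c t - a) \<bullet> c2 t)) has_real_derivative
          2 * (0 + (c1 s \<bullet> c2 s + (c s - a) \<bullet> c3 s))) (at s)"
        by (intro DERIV_cmult DERIV_add DERIV_const has_real_derivative_inner ca c3 J)
      then show "((\<lambda>t. 2 * (1 + (c t - a) \<bullet> c2 t)) has_real_derivative
          2 * ((c s - a) \<bullet> c3 s)) (at s)"
        by (simp add: c1c2 [OF J(2)])
    qed
    then have 1: "(c s - a) \<bullet> c3 s = 0" using third by simp
    \<comment> \<open>Contact of order 0 puts \<open>c s\<close> at distance \<open>r > 0\<close>
      from the centre, so the radius vector can serve as the conormal \<open>m\<close>.\<close>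
    have "c s - a \<noteq> 0" using zero \<open>r > 0\<close> by (auto simp: \<phi>)
    moreover have "(c s - a) \<bullet> w = 0" if "w \<in> tangent_space {x. \<phi> x = 0} (c s)" for w
    proof -
      have "(\<phi> has_derivative (\<lambda>h. 2 * ((c s - a) \<bullet> h))) (at (c s))"
        unfolding \<phi>' by (auto intro!: derivative_eq_intros simp: inner_commute)
      from tangent_space_level_set [OF this that] show ?thesis by simp
    qed
    ultimately show thesis using that 1 by blast
  next
    assume "plane_equation \<phi>"
    then obtain a b where "a \<noteq> 0" and \<phi>: "\<phi> = (\<lambda>x. a \<bullet> x - b)"
      unfolding plane_equation_def by blast
    have ia: "((\<lambda>t. a \<bullet> f t) has_real_derivative a \<bullet> f') (at t)"
      if "(f has_vector_derivative f') (at t)" for f f' t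
      using has_real_derivative_inner [OF has_vector_derivative_const that] by simp
    have "(deriv ^^ 3) (\<phi> \<circ> c) s = a \<bullet> c3 s"
    proof (rule deriv_3_eqI [OF J])
      fix t assume t: "t \<in> J"
      show "((\<phi> \<circ> c) has_real_derivative a \<bullet> c1 t) (at t)"
        using DERIV_diff [OF ia [OF c1 [OF t]] DERIV_const [of b]] unfolding \<phi> by (simp add: o_def)
      show "((\<lambda>t. a \<bullet> c1 t) has_real_derivative a \<bullet> c2 t) (at t)" by (rule ia [OF c2 [OF t]])
    next
      show "((\<lambda>t. a \<bullet> c2 t) has_real_derivative a \<bullet> c3 s) (at s)" by (rule ia [OF c3 [OF J(2)]])
    qed
    then have 1: "a \<bullet> c3 s = 0" using third by simp
    have "a \<bullet> w = 0" if "w \<in> tangent_space {x. \<phi> x = 0} (c s)" for w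
    proof -
      have "(\<phi> has_derivative (\<lambda>h. a \<bullet> h)) (at (c s))"
        unfolding \<phi> by (auto intro!: derivative_eq_intros)
      from tangent_space_level_set [OF this that] show ?thesis .
    qed
    then show thesis using that 1 \<open>a \<noteq> 0\<close> by blast
  qed
qed

section \<open>Normal vectors of the surface\<close>

text \<open>If the component \<open>w\<close> of \<open>n\<close> orthogonal to \<open>m\<close>
  were nonzero, then \<open>x\<close>, \<open>y\<close>, \<open>m\<close>, \<open>w\<close> would be
  four nonzero pairwise orthogonal vectors in a space of dimension 3.\<close>

lemma normals_parallel:
  fixes x y m n :: "real^3"
  assumes "x \<bullet> y = 0" and "x \<noteq> 0" and "y \<noteq> 0"
    and "m \<bullet> x = 0" and "m \<bullet> y = 0" and "n \<bullet> x = 0" and "n \<bullet> y = 0" and "m \<noteq> 0"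
  obtains r where "n = r *\<^sub>R m"
proof -
  define w where "w = n - ((n \<bullet> m) / (m \<bullet> m)) *\<^sub>R m"
  have w: "w \<bullet> x = 0" "w \<bullet> y = 0" "w \<bullet> m = 0"
    using assms by (simp_all add: w_def inner_diff_left)
  have "w = 0"
  proof (rule ccontr)
    assume "w \<noteq> 0"
    have ne: "p \<noteq> q" if "p \<bullet> q = 0" "p \<noteq> 0" for p q :: "real^3" using that by auto
    have "pairwise orthogonal {x, y, m, w}"
      using assms w by (auto simp: pairwise_insert orthogonal_def inner_commute)
    then have "independent {x, y, m, w}"
      using assms \<open>w \<noteq> 0\<close> by (intro pairwise_orthogonal_independent) auto
    from independent_bound [OF this] have "card {x, y, m, w} \<le> 3" by simp
    moreover have "card {x, y, m, w} = 4"
      using assms w \<open>w \<noteq> 0\<close> ne [of x y] ne [of m x] ne [of m y] ne [of w x] ne [of w y] ne [of w m]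
      by auto
    ultimately show False by simp
  qed
  then show thesis using that by (simp add: w_def)
qed

lemma orientation_normal:
  assumes "orientation M N" and "chart M U X" and "p \<in> U"
  shows "d_u X p \<bullet> N (X p) = 0" and "d_v X p \<bullet> N (X p) = 0"
proof -
  have "X p \<in> M" using assms(2,3) openin_imp_subset unfolding chart_def by blast
  with assms(1) have "\<forall>w\<in>tangent_space M (X p). N (X p) \<bullet> w = 0"
    unfolding orientation_def by blast
  then show "d_u X p \<bullet> N (X p) = 0" and "d_v X p \<bullet> N (X p) = 0"
    using chart_d_u_d_v(1,2) [OF assms(2,3)] by (simp_all add: inner_commute)
qed

lemma smooth_on_unit_normal:
  assumes "orientation M N" and "chart M U X"
  shows "smooth_on U (\<lambda>p. N (X p))"
  using assms unfolding orientation_def o_def by blast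

section \<open>The equations of Rodrigues and Codazzi\<close>

text \<open>Rodrigues' formula. The definition of a line of curvature only provides some eigenvalues
  \<open>k\<close> and \<open>l\<close>. Differentiating X_u . N = 0 and X_v . N = 0 gives e = k E
  and g = l G, which identifies them as the principal curvatures.\<close>

lemma principal_chart_normal_derivative:
  assumes ori: "orientation M N" and pc: "principal_chart M N U X" and p: "p \<in> U"
  shows "d_u (\<lambda>q. N (X q)) p = - (curvature_1 X N p *\<^sub>R d_u X p)"
    and "d_v (\<lambda>q. N (X q)) p = - (curvature_2 X N p *\<^sub>R d_v X p)"
proof -
  have ch: "chart M U X" using pc unfolding principal_chart_def by blast
  then have U: "open U" and X: "smooth_on U X" unfolding chart_def by blast+
  note sm = smooth_on_partial_derivatives [OF U X]
  note dif = smooth_on_differentiable [OF sm(1) p] smooth_on_differentiable [OF sm(2) p]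
    smooth_on_differentiable [OF smooth_on_unit_normal [OF ori ch] p]
  note orth = orientation_normal [OF ori ch]
  obtain a b where ab: "p = (a, b)" by fastforce
  have "line_of_curvature N {t. (t, b) \<in> U} (\<lambda>t. X (t, b))"
    "line_of_curvature N {t. (a, t) \<in> U} (\<lambda>t. X (a, t))"
    using pc unfolding principal_chart_def by blast+
  then obtain k l where
    "(N \<circ> (\<lambda>t. X (t, b)) has_vector_derivative
       - (k *\<^sub>R vector_derivative (\<lambda>t. X (t, b)) (at a))) (at a)"
    "(N \<circ> (\<lambda>t. X (a, t)) has_vector_derivative
       - (l *\<^sub>R vector_derivative (\<lambda>t. X (a, t)) (at b))) (at b)"
    using p unfolding line_of_curvature_def ab by blast
  from this [THEN vector_derivative_at]
  have u: "d_u (\<lambda>q. N (X q)) p = - (k *\<^sub>R d_u X p)"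
    and v: "d_v (\<lambda>q. N (X q)) p = - (l *\<^sub>R d_v X p)"
    by (simp_all add: d_u_def d_v_def ab o_def)
  have "coeff_e X N p = k * coeff_E X p" "coeff_g X N p = l * coeff_G X p"
    using inner_eq_zero_on_open(1) [OF U p orth(1) dif(1,3)] u
      inner_eq_zero_on_open(2) [OF U p orth(2) dif(2,3)] v
    by (simp_all add: coeff_e_def coeff_g_def coeff_E_def coeff_G_def)
  moreover have "coeff_E X p \<noteq> 0" "coeff_G X p \<noteq> 0"
    using chart_d_u_d_v(3,4) [OF ch p] by (simp_all add: coeff_E_def coeff_G_def)
  ultimately have "k = curvature_1 X N p" "l = curvature_2 X N p"
    by (simp_all add: curvature_1_def curvature_2_def)
  with u v show "d_u (\<lambda>q. N (X q)) p = - (curvature_1 X N p *\<^sub>R d_u X p)"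
    and "d_v (\<lambda>q. N (X q)) p = - (curvature_2 X N p *\<^sub>R d_v X p)"
    by simp_all
qed

lemma curvature_differentiable:
  assumes "orientation M N" and ch: "chart M U X" and p: "p \<in> U"
  shows "curvature_1 X N differentiable (at p)" and "curvature_2 X N differentiable (at p)"
proof -
  have U: "open U" and X: "smooth_on U X" using ch unfolding chart_def by blast+
  note sm = smooth_on_partial_derivatives [OF U X]
  note dif = smooth_on_differentiable [OF sm(1) p] smooth_on_differentiable [OF sm(2) p]
    smooth_on_differentiable [OF smooth_on_partial_derivatives(1) [OF U sm(1)] p]
    smooth_on_differentiable [OF smooth_on_partial_derivatives(2) [OF U sm(2)] p]
    smooth_on_differentiable [OF smooth_on_unit_normal [OF assms(1) ch] p]
  have ne: "d_u X p \<bullet> d_u X p \<noteq> 0" "d_v X p \<bullet> d_v X p \<noteq> 0"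
    using chart_d_u_d_v(3,4) [OF ch p] by simp_all
  show "curvature_1 X N differentiable (at p)"
    unfolding curvature_1_def [abs_def] coeff_e_def coeff_E_def
    by (intro differentiable_divide differentiable_inner dif ne)
  show "curvature_2 X N differentiable (at p)"
    unfolding curvature_2_def [abs_def] coeff_g_def coeff_G_def
    by (intro differentiable_divide differentiable_inner dif ne)
qed

text \<open>Differentiate N_u = - k1 X_u in v and N_v = - k2 X_v in u. The mixed partials of N and
  of X are symmetric, which leaves a vector identity in X_u, X_v and X_uv; orthogonality of X_u and
  X_v isolates one curvature derivative in each pairing.\<close>

lemma codazzi:
  assumes ori: "orientation M N" and pc: "principal_chart M N U X" and p: "p \<in> U"
    and F: "\<And>q. q \<in> U \<Longrightarrow> d_u X q \<bullet> d_v X q = 0"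
  shows "d_v (curvature_1 X N) p * (d_u X p \<bullet> d_u X p)
      = (curvature_2 X N p - curvature_1 X N p) * (d_v (d_u X) p \<bullet> d_u X p)"
    and "d_u (curvature_2 X N) p * (d_v X p \<bullet> d_v X p)
      = (curvature_1 X N p - curvature_2 X N p) * (d_v (d_u X) p \<bullet> d_v X p)"
proof -
  define k1 where "k1 = curvature_1 X N"
  define k2 where "k2 = curvature_2 X N"
  have ch: "chart M U X" using pc unfolding principal_chart_def by blast
  then have U: "open U" and X: "smooth_on U X" unfolding chart_def by blast+
  note sm = smooth_on_partial_derivatives [OF U X]
  note dif = smooth_on_differentiable [OF sm(1) p] smooth_on_differentiable [OF sm(2) p]
  have k: "(\<lambda>q. - k1 q) differentiable (at p)" "(\<lambda>q. - k2 q) differentiable (at p)"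
    using curvature_differentiable [OF ori ch p] unfolding k1_def k2_def
    by (auto intro: differentiable_minus)
  let ?n = "\<lambda>q. N (X q)"
  have n: "d_u ?n q = (- k1 q) *\<^sub>R d_u X q" "d_v ?n q = (- k2 q) *\<^sub>R d_v X q" if "q \<in> U" for q
    using principal_chart_normal_derivative [OF ori pc that] by (simp_all add: k1_def k2_def)
  have k': "d_v (\<lambda>q. - k1 q) p = - d_v k1 p" "d_u (\<lambda>q. - k2 q) p = - d_u k2 p"
    using d_u_d_v_eqI [OF has_derivative_minus [OF has_derivative_d_u_d_v(1)
        [OF curvature_differentiable(1) [OF ori ch p]]]]
      d_u_d_v_eqI [OF has_derivative_minus [OF has_derivative_d_u_d_v(1)
        [OF curvature_differentiable(2) [OF ori ch p]]]]
    by (simp_all add: k1_def k2_def)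
  have XX: "d_u (d_v X) p = d_v (d_u X) p" using smooth_on_mixed_partials_eq [OF U X p] by simp
  \<comment> \<open>Rodrigues' formula holds throughout the open set \<open>U\<close>, so both of
    its sides may be differentiated at \<open>p\<close>.\<close>
  have "d_v (d_u ?n) p = d_v (\<lambda>q. (- k1 q) *\<^sub>R d_u X q) p"
    by (rule d_u_d_v_cong [OF U p]) (use n differentiable_scaleR [OF k(1) dif(1)] in auto)
  moreover have "d_u (d_v ?n) p = d_u (\<lambda>q. (- k2 q) *\<^sub>R d_v X q) p"
    by (rule d_u_d_v_cong [OF U p]) (use n differentiable_scaleR [OF k(2) dif(2)] in auto)
  moreover have "d_v (d_u ?n) p = d_u (d_v ?n) p"
    by (rule smooth_on_mixed_partials_eq [OF U smooth_on_unit_normal [OF ori ch] p])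
  ultimately have eq: "d_v k1 p *\<^sub>R d_u X p + k1 p *\<^sub>R d_v (d_u X) p
      = d_u k2 p *\<^sub>R d_v X p + k2 p *\<^sub>R d_v (d_u X) p"
    unfolding d_u_d_v_scaleR(2) [OF k(1) dif(1)] d_u_d_v_scaleR(1) [OF k(2) dif(2)] k' XX
    by (simp add: algebra_simps)
  have F': "d_v X p \<bullet> d_u X p = 0" using F [OF p] by (simp add: inner_commute)
  show "d_v (curvature_1 X N) p * (d_u X p \<bullet> d_u X p)
      = (curvature_2 X N p - curvature_1 X N p) * (d_v (d_u X) p \<bullet> d_u X p)"
    using arg_cong [OF eq, of "\<lambda>w. w \<bullet> d_u X p"] F'
    unfolding k1_def [symmetric] k2_def [symmetric] by (simp add: inner_add_left algebra_simps)
  show "d_u (curvature_2 X N) p * (d_v X p \<bullet> d_v X p)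
      = (curvature_1 X N p - curvature_2 X N p) * (d_v (d_u X) p \<bullet> d_v X p)"
    using arg_cong [OF eq, of "\<lambda>w. w \<bullet> d_v X p"] F [OF p]
    unfolding k1_def [symmetric] k2_def [symmetric] by (simp add: inner_add_left algebra_simps)
qed

section \<open>Algebraic elimination of the second derivatives\<close>

text \<open>Here \<open>A\<close>, \<open>B\<close> stand for \<open>c'' \<bullet> X\<^sub>u\<close>, \<open>c'' \<bullet> X\<^sub>v\<close>, and \<open>P\<close>, \<open>Q\<close>, \<open>R\<close>, \<open>T\<close> for
  \<open>X\<^sub>u\<^sub>u \<bullet> X\<^sub>u\<close>, \<open>X\<^sub>u\<^sub>v \<bullet> X\<^sub>u\<close>, \<open>X\<^sub>u\<^sub>v \<bullet> X\<^sub>v\<close>, \<open>X\<^sub>v\<^sub>v \<bullet> X\<^sub>v\<close>.\<close>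

lemma darboux_algebra:
  fixes a b :: real
  assumes "a > 0" and "b > 0"
    and "U = C / a" and "V = S / b"
    and "A + (U * (U * P + V * Q) + V * (V * R - U * Q)) = (U * P + V * Q) / a * C - a * (S * d)"
    and "B + (U * (U * Q - V * R) + V * (U * R + V * T)) = (U * R + V * T) / b * S + b * (C * d)"
    and "k1v * a\<^sup>2 = (k2 - k1) * Q" and "k2u * b\<^sup>2 = (k1 - k2) * R"
    and "- (k1 * U * A + k2 * V * B)
      = (U * k1u + V * k1v) * C\<^sup>2 + (U * k2u + V * k2v) * S\<^sup>2 + 2 * (k2 - k1) * S * C * d"
  shows "3 * (k1 - k2) * S * C * d = 1 / a * k1u * C ^ 3 + 1 / b * k2v * S ^ 3"
proof -
  \<comment> \<open>Writing \<open>C\<close> and \<open>S\<close> through the velocity components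
    removes the denominators, so that the identities become polynomial.\<close>
  have C: "C = U * a" and S: "S = V * b" using assms(1-4) by simp_all
  have "(U * P + V * Q) / a * C = (U * P + V * Q) * U" "(U * R + V * T) / b * S = (U * R + V * T) * V"
    unfolding C S using assms(1,2) by simp_all
  then have "A = (U * P + V * Q) * U - a * (S * d) - (U * (U * P + V * Q) + V * (V * R - U * Q))"
    "B = (U * R + V * T) * V + b * (C * d) - (U * (U * Q - V * R) + V * (U * R + V * T))"
    using assms(5,6) by linarith+
  \<comment> \<open>\<open>P\<close> and \<open>T\<close> cancel here; only the products
    \<open>Q\<close> and \<open>R\<close> with X_uv survive.\<close>
  then have A: "A = Q * U * V - R * V\<^sup>2 - a * (S * d)" and B: "B = R * U * V - Q * U\<^sup>2 + b * (C * d)"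
    unfolding power2_eq_square by algebra+
  \<comment> \<open>\<open>X\<close> and \<open>Y\<close> collect the X_uv terms of
    \<open>- (k1 * U * A + k2 * V * B)\<close>. By the Codazzi hypotheses they equal
    \<open>V * k1v * C\<^sup>2\<close> and \<open>U * k2u * S\<^sup>2\<close>, so they drop out of
    the equation. \<open>Z\<close> occurs once on this side and as \<open>- 2 * Z\<close> on the
    other, whence the factor 3.\<close>
  define X where "X = U\<^sup>2 * V * ((k2 - k1) * Q)"
  define Y where "Y = U * V\<^sup>2 * ((k1 - k2) * R)"
  define Z where "Z = (k1 - k2) * S * C * d"
  have "- (k1 * U * A + k2 * V * B) = X + Y + Z"
    unfolding A B C S X_def Y_def Z_def by algebra
  moreover have "(U * k1u + V * k1v) * C\<^sup>2 + (U * k2u + V * k2v) * S\<^sup>2 + 2 * (k2 - k1) * S * C * d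
      = U * k1u * C\<^sup>2 + V * k1v * C\<^sup>2 + U * k2u * S\<^sup>2 + V * k2v * S\<^sup>2 - 2 * Z"
    unfolding Z_def by algebra
  moreover have "V * k1v * C\<^sup>2 = X" "U * k2u * S\<^sup>2 = Y"
    unfolding X_def Y_def assms(7,8) [symmetric] C S by algebra+
  ultimately have "3 * Z = U * k1u * C\<^sup>2 + V * k2v * S\<^sup>2"
    using assms(9) by linarith
  moreover have "U * k1u * C\<^sup>2 = 1 / a * k1u * C ^ 3" "V * k2v * S\<^sup>2 = 1 / b * k2v * S ^ 3"
    unfolding assms(3,4) by (simp_all add: power2_eq_square power3_eq_cube)
  moreover have "3 * (k1 - k2) * S * C * d = 3 * Z"
    unfolding Z_def by simp
  ultimately show ?thesis by simp
qed

lemma has_real_derivative_norm: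
  fixes f :: "real \<Rightarrow> 'b::real_inner"
  assumes "(f has_vector_derivative f') (at s)" and "f s \<noteq> 0"
  shows "((\<lambda>t. norm (f t)) has_real_derivative f s \<bullet> f' / norm (f s)) (at s)"
  using has_derivative_compose [OF assms(1) [unfolded has_vector_derivative_def]
      has_derivative_norm [OF assms(2)]]
  unfolding has_field_derivative_def
  by (rule has_derivative_eq_rhs)
     (simp add: fun_eq_iff sgn_div_norm inner_commute divide_inverse mult_ac)

section \<open>The Darboux condition along the curve\<close>

theorem proposition16:
  fixes M :: "(real^3) set" and N :: "real^3 \<Rightarrow> real^3"
    and U :: "(real \<times> real) set" and X :: "real \<times> real \<Rightarrow> real^3"
    and J :: "real set" and u v \<alpha> :: "real \<Rightarrow> real"
  assumes "smooth_surface M" and "orientation M N"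
    and "principal_chart M N U X"
    and "\<forall>p\<in>U. coeff_F X p = 0" and "\<forall>p\<in>U. coeff_f X N p = 0"
    and "open J" and "is_interval J"
    and "smooth_on J u" and "smooth_on J v" and "\<forall>s\<in>J. (u s, v s) \<in> U"
    and "\<forall>s\<in>J. norm (vector_derivative (\<lambda>t. X (u t, v t)) (at s)) = 1"
    and "\<forall>s\<in>J. \<alpha> differentiable (at s)"
    and "\<forall>s\<in>J. deriv u s = cos (\<alpha> s) / sqrt (coeff_E X (u s, v s))"
    and "\<forall>s\<in>J. deriv v s = sin (\<alpha> s) / sqrt (coeff_G X (u s, v s))"
    and "darboux_curve M J (\<lambda>s. X (u s, v s))"
  shows "\<forall>s\<in>J.
    3 * (curvature_1 X N (u s, v s) - curvature_2 X N (u s, v s))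
      * sin (\<alpha> s) * cos (\<alpha> s) * deriv \<alpha> s
    = 1 / sqrt (coeff_E X (u s, v s)) * d_u (curvature_1 X N) (u s, v s) * cos (\<alpha> s) ^ 3
      + 1 / sqrt (coeff_G X (u s, v s)) * d_v (curvature_2 X N) (u s, v s) * sin (\<alpha> s) ^ 3"
proof
  fix s assume s: "s \<in> J"
  note ori = assms(2) and pc = assms(3) and J = assms(6)
  have ch: "chart M U X" using pc unfolding principal_chart_def by blast
  then have U: "open U" and X: "smooth_on U X" unfolding chart_def by blast+
  have uvU: "(u t, v t) \<in> U" if "t \<in> J" for t using assms(10) that by blast
  have F: "d_u X q \<bullet> d_v X q = 0" if "q \<in> U" for q
    using assms(4) that by (simp add: coeff_F_def)
  note dX = smooth_on_partial_derivatives [OF U X]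

  define c where "c = (\<lambda>t. X (u t, v t))"
  define x where "x = (\<lambda>t. d_u X (u t, v t))"
  define y where "y = (\<lambda>t. d_v X (u t, v t))"
  define n where "n = (\<lambda>t. N (X (u t, v t)))"
  define \<kappa>1 where "\<kappa>1 = (\<lambda>t. curvature_1 X N (u t, v t))"
  define \<kappa>2 where "\<kappa>2 = (\<lambda>t. curvature_2 X N (u t, v t))"
  \<comment> \<open>The square roots of E and G appear as norms of the coordinate vectors, so their
    derivatives come from differentiating a norm.\<close>
  define a where "a = (\<lambda>t. norm (x t))"
  define b where "b = (\<lambda>t. norm (y t))"
  define u' where "u' t = cos (\<alpha> t) / a t" for t
  define v' where "v' t = sin (\<alpha> t) / b t" for t

  have aE: "sqrt (coeff_E X (u t, v t)) = a t" and bG: "sqrt (coeff_G X (u t, v t)) = b t" for t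
    by (simp_all add: a_def b_def x_def y_def coeff_E_def coeff_G_def norm_eq_sqrt_inner)
  have pos: "a t > 0" "b t > 0" if "t \<in> J" for t
    using chart_d_u_d_v(3,4) [OF ch uvU [OF that]] by (simp_all add: a_def b_def x_def y_def)
  have sq: "x t \<bullet> x t = (a t)\<^sup>2" "y t \<bullet> y t = (b t)\<^sup>2" for t
    by (simp_all add: a_def b_def power2_norm_eq_inner)
  have orth: "x t \<bullet> y t = 0" "x t \<bullet> n t = 0" "y t \<bullet> n t = 0" if "t \<in> J" for t
    using F [OF uvU [OF that]] orientation_normal [OF ori ch uvU [OF that]]
    by (simp_all add: x_def y_def n_def)

  have du: "(u has_real_derivative u' t) (at t)" if "t \<in> J" for t
    using smooth_on_differentiable [OF assms(8) that] assms(13) that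
    by (metis u'_def aE DERIV_deriv_iff_real_differentiable)
  have dv: "(v has_real_derivative v' t) (at t)" if "t \<in> J" for t
    using smooth_on_differentiable [OF assms(9) that] assms(14) that
    by (metis v'_def bG DERIV_deriv_iff_real_differentiable)
  have d\<alpha>: "(\<alpha> has_real_derivative deriv \<alpha> s) (at s)"
    using assms(12) s by (simp add: DERIV_deriv_iff_real_differentiable)

  have dcos: "((\<lambda>t. cos (\<alpha> t)) has_real_derivative - sin (\<alpha> s) * deriv \<alpha> s) (at s)"
    by (rule DERIV_chain2 [OF DERIV_cos d\<alpha>])
  have dsin: "((\<lambda>t. sin (\<alpha> t)) has_real_derivative cos (\<alpha> s) * deriv \<alpha> s) (at s)"
    by (rule DERIV_chain2 [OF DERIV_sin d\<alpha>])

  have along: "((\<lambda>t. f (u t, v t)) has_vector_derivative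
      u' t *\<^sub>R d_u f (u t, v t) + v' t *\<^sub>R d_v f (u t, v t)) (at t)"
    if "f differentiable (at (u t, v t))" "t \<in> J" for f :: "real \<times> real \<Rightarrow> 'z::real_normed_vector" and t
    by (rule has_vector_derivative_along_curve [OF that(1) du [OF that(2)] dv [OF that(2)]])

  define Xuu where "Xuu = d_u (d_u X) (u s, v s)"
  define Xuv where "Xuv = d_v (d_u X) (u s, v s)"
  define Xvv where "Xvv = d_v (d_v X) (u s, v s)"
  define x' where "x' = u' s *\<^sub>R Xuu + v' s *\<^sub>R Xuv"
  define y' where "y' = u' s *\<^sub>R Xuv + v' s *\<^sub>R Xvv"
  have Xvu: "d_u (d_v X) (u s, v s) = Xuv"
    unfolding Xuv_def using smooth_on_mixed_partials_eq [OF U X uvU [OF s]] by simp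
  have x': "(x has_vector_derivative x') (at s)"
    unfolding x_def x'_def Xuu_def Xuv_def
    by (intro along s smooth_on_differentiable [OF dX(1)] uvU)
  have y': "(y has_vector_derivative y') (at s)"
    unfolding y_def y'_def Xvu [symmetric] Xvv_def
    by (intro along s smooth_on_differentiable [OF dX(2)] uvU)
  have ne: "x s \<noteq> 0" "y s \<noteq> 0" using pos [OF s] by (auto simp: a_def b_def)
  have da: "(a has_real_derivative x s \<bullet> x' / a s) (at s)"
    unfolding a_def by (rule has_real_derivative_norm [OF x' ne(1)])
  have db: "(b has_real_derivative y s \<bullet> y' / b s) (at s)"
    unfolding b_def by (rule has_real_derivative_norm [OF y' ne(2)])
  have n': "(n has_vector_derivative
      - (\<kappa>1 t * u' t) *\<^sub>R x t - (\<kappa>2 t * v' t) *\<^sub>R y t) (at t)" if "t \<in> J" for t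
    using along [OF smooth_on_differentiable [OF smooth_on_unit_normal [OF ori ch] uvU [OF that]] that]
      principal_chart_normal_derivative [OF ori pc uvU [OF that]]
    by (simp add: n_def x_def y_def \<kappa>1_def \<kappa>2_def mult.commute)
  have \<kappa>1': "(\<kappa>1 has_real_derivative u' s * d_u (curvature_1 X N) (u s, v s)
      + v' s * d_v (curvature_1 X N) (u s, v s)) (at s)"
    using along [OF curvature_differentiable(1) [OF ori ch uvU [OF s]] s]
    by (simp add: \<kappa>1_def has_real_derivative_iff_has_vector_derivative)
  have \<kappa>2': "(\<kappa>2 has_real_derivative u' s * d_u (curvature_2 X N) (u s, v s)
      + v' s * d_v (curvature_2 X N) (u s, v s)) (at s)"
    using along [OF curvature_differentiable(2) [OF ori ch uvU [OF s]] s]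
    by (simp add: \<kappa>2_def has_real_derivative_iff_has_vector_derivative)

  \<comment> \<open>Differentiating F = 0 expresses these two products through X_uv, leaving only
    the four products used in \<open>darboux_algebra\<close>.\<close>
  have mixed: "Xuu \<bullet> y s = - (Xuv \<bullet> x s)" "Xvv \<bullet> x s = - (Xuv \<bullet> y s)"
    using inner_eq_zero_on_open [OF U uvU [OF s] F smooth_on_differentiable [OF dX(1) uvU [OF s]]
        smooth_on_differentiable [OF dX(2) uvU [OF s]]]
    unfolding Xvu by (simp_all add: Xuu_def Xuv_def Xvv_def x_def y_def inner_commute)

  define c1 where "c1 t = vector_derivative c (at t)" for t
  define c2 where "c2 t = vector_derivative c1 (at t)" for t
  define c3 where "c3 t = vector_derivative c2 (at t)" for t
  \<comment> \<open>\<open>\<alpha>\<close> is only assumed differentiable, so the third derivative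
    of \<open>c\<close> is obtained from the smoothness contained in \<open>darboux_curve\<close>
    and not by differentiating a formula in \<open>\<alpha>\<close>.\<close>
  have "smooth_on J c" using assms(15) unfolding darboux_curve_def c_def by blast
  note sm1 = smooth_on_has_vector_derivative [OF this J, folded c1_def]
  note sm2 = smooth_on_has_vector_derivative [OF sm1(2) J, folded c2_def]
  note sm3 = smooth_on_has_vector_derivative [OF sm2(2) J, folded c3_def]
  have c1: "c1 t = u' t *\<^sub>R x t + v' t *\<^sub>R y t" if "t \<in> J" for t
    using vector_derivative_at [OF along [OF smooth_on_differentiable [OF X uvU [OF that]] that]]
    by (simp add: c1_def c_def x_def y_def)

  have c3n: "c3 s \<bullet> n s = 0"
  proof -
    obtain \<phi> where \<phi>: "osculating_sphere \<phi> c s"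
      and tan: "tangent_space {x. \<phi> x = 0} (c s) = tangent_space M (c s)"
      using assms(15) s unfolding darboux_curve_def c_def by blast
    have unit: "norm (c1 t) = 1" if "t \<in> J" for t
      using assms(11) that by (simp add: c1_def c_def)
    obtain m where m: "m \<noteq> 0" "m \<bullet> c3 s = 0"
      and mt: "\<And>w. w \<in> tangent_space {x. \<phi> x = 0} (c s) \<Longrightarrow> m \<bullet> w = 0"
      using osculating_sphere_conormal [OF \<phi> J s sm1(1) sm2(1) sm3(1) unit] by blast
    \<comment> \<open>The sphere or plane has the same tangent space at \<open>c s\<close> as
      \<open>M\<close>, so its conormal \<open>m\<close> annihilates both coordinate vectors and is
      parallel to the surface normal.\<close>
    have "m \<bullet> x s = 0" "m \<bullet> y s = 0"
      using chart_d_u_d_v(1,2) [OF ch uvU [OF s]]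
      by (auto intro!: mt simp: tan [unfolded c_def] x_def y_def c_def)
    then obtain r where "n s = r *\<^sub>R m"
      using normals_parallel [of "x s" "y s" m "n s"] orth [OF s] m(1) ne by (auto simp: inner_commute)
    then show ?thesis using m(2) by (simp add: inner_commute)
  qed

  \<comment> \<open>Used repeatedly: a scalar product along the curve also has a closed form on
    \<open>J\<close>, and uniqueness of derivatives equates the two ways of differentiating
    it.\<close>
  have inner_const: "f' = D" if "(f has_real_derivative f') (at t)" "(g has_real_derivative D) (at t)"
    "t \<in> J" "\<And>t. t \<in> J \<Longrightarrow> f t = g t" for f g :: "real \<Rightarrow> real" and f' D t
    using DERIV_unique has_field_derivative_transform_within_open [OF that(1) J that(3,4)] that(2)
    by blast

  have c1x: "c1 t \<bullet> x t = a t * cos (\<alpha> t)" and c1y: "c1 t \<bullet> y t = b t * sin (\<alpha> t)"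
    if "t \<in> J" for t
    using pos [OF that] orth(1) [OF that] sq [of t] c1 [OF that]
    by (simp_all add: inner_add_left inner_commute [of "y t" "x t"] u'_def v'_def power2_eq_square)
  have "((\<lambda>t. a t * cos (\<alpha> t)) has_real_derivative
      x s \<bullet> x' / a s * cos (\<alpha> s) - a s * (sin (\<alpha> s) * deriv \<alpha> s)) (at s)"
    using DERIV_mult [OF da dcos] by (rule DERIV_cong) simp
  from inner_const [OF has_real_derivative_inner [OF sm2(1) [OF s] x'] this s c1x]
  have c2x: "c2 s \<bullet> x s + c1 s \<bullet> x' = x s \<bullet> x' / a s * cos (\<alpha> s) - a s * (sin (\<alpha> s) * deriv \<alpha> s)" .
  have "((\<lambda>t. b t * sin (\<alpha> t)) has_real_derivative
      y s \<bullet> y' / b s * sin (\<alpha> s) + b s * (cos (\<alpha> s) * deriv \<alpha> s)) (at s)"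
    using DERIV_mult [OF db dsin] by (rule DERIV_cong) simp
  from inner_const [OF has_real_derivative_inner [OF sm2(1) [OF s] y'] this s c1y]
  have c2y: "c2 s \<bullet> y s + c1 s \<bullet> y' = y s \<bullet> y' / b s * sin (\<alpha> s) + b s * (cos (\<alpha> s) * deriv \<alpha> s)" .
  \<comment> \<open>Euler's formula for the normal curvature, from differentiating
    \<open>c1 t \<bullet> n t = 0\<close>. It is proved on all of \<open>J\<close> because it is
    differentiated again at \<open>s\<close>.\<close>
  have c2n: "c2 t \<bullet> n t = \<kappa>1 t * (cos (\<alpha> t))\<^sup>2 + \<kappa>2 t * (sin (\<alpha> t))\<^sup>2" if t: "t \<in> J" for t
  proof -
    have "c2 t \<bullet> n t + c1 t \<bullet> (- (\<kappa>1 t * u' t) *\<^sub>R x t - (\<kappa>2 t * v' t) *\<^sub>R y t) = 0"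
      by (rule inner_const [OF has_real_derivative_inner [OF sm2(1) [OF t] n' [OF t]]
            DERIV_const [of 0] t])
         (simp add: c1 orth inner_add_left)
    then show ?thesis
      using pos [OF t] orth [OF t] sq [of t]
      by (simp add: c1 [OF t] inner_add_left inner_diff_right inner_commute [of "y t" "x t"]
          u'_def v'_def power2_eq_square)
  qed
  have "((\<lambda>t. \<kappa>1 t * (cos (\<alpha> t))\<^sup>2 + \<kappa>2 t * (sin (\<alpha> t))\<^sup>2) has_real_derivative
      (u' s * d_u (curvature_1 X N) (u s, v s) + v' s * d_v (curvature_1 X N) (u s, v s)) * (cos (\<alpha> s))\<^sup>2
      + (u' s * d_u (curvature_2 X N) (u s, v s) + v' s * d_v (curvature_2 X N) (u s, v s)) * (sin (\<alpha> s))\<^sup>2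
      + 2 * (\<kappa>2 s - \<kappa>1 s) * sin (\<alpha> s) * cos (\<alpha> s) * deriv \<alpha> s) (at s)"
    using DERIV_add [OF DERIV_mult [OF \<kappa>1' DERIV_power [OF dcos, of 2]]
        DERIV_mult [OF \<kappa>2' DERIV_power [OF dsin, of 2]]]
    by (rule DERIV_cong) (simp add: algebra_simps)
  from inner_const [OF has_real_derivative_inner [OF sm3(1) [OF s] n' [OF s]] this s c2n]
  have c3: "c3 s \<bullet> n s + c2 s \<bullet> (- (\<kappa>1 s * u' s) *\<^sub>R x s - (\<kappa>2 s * v' s) *\<^sub>R y s)
    = (u' s * d_u (curvature_1 X N) (u s, v s) + v' s * d_v (curvature_1 X N) (u s, v s)) * (cos (\<alpha> s))\<^sup>2
      + (u' s * d_u (curvature_2 X N) (u s, v s) + v' s * d_v (curvature_2 X N) (u s, v s)) * (sin (\<alpha> s))\<^sup>2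
      + 2 * (\<kappa>2 s - \<kappa>1 s) * sin (\<alpha> s) * cos (\<alpha> s) * deriv \<alpha> s" .
  have xx': "x s \<bullet> x' = u' s * (Xuu \<bullet> x s) + v' s * (Xuv \<bullet> x s)"
    and yy': "y s \<bullet> y' = u' s * (Xuv \<bullet> y s) + v' s * (Xvv \<bullet> y s)"
    by (simp_all add: x'_def y'_def inner_add_right inner_commute)
  \<comment> \<open>\<open>mixed\<close> eliminates the products of X_uu with X_v and of X_vv with
    X_u.\<close>
  have c1x': "c1 s \<bullet> x' = u' s * (u' s * (Xuu \<bullet> x s) + v' s * (Xuv \<bullet> x s))
      + v' s * (v' s * (Xuv \<bullet> y s) - u' s * (Xuv \<bullet> x s))"
    and c1y': "c1 s \<bullet> y' = u' s * (u' s * (Xuv \<bullet> x s) - v' s * (Xuv \<bullet> y s))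
      + v' s * (u' s * (Xuv \<bullet> y s) + v' s * (Xvv \<bullet> y s))"
    using mixed unfolding c1 [OF s] inner_add_left inner_scaleR_left xx' yy'
    by (simp_all add: x'_def y'_def inner_add_right inner_commute [of "x s"] inner_commute [of "y s"]
        algebra_simps)
  have cod: "d_v (curvature_1 X N) (u s, v s) * (a s)\<^sup>2 = (\<kappa>2 s - \<kappa>1 s) * (Xuv \<bullet> x s)"
    "d_u (curvature_2 X N) (u s, v s) * (b s)\<^sup>2 = (\<kappa>1 s - \<kappa>2 s) * (Xuv \<bullet> y s)"
    using codazzi [OF ori pc uvU [OF s] F]
    by (simp_all add: sq [symmetric] x_def y_def Xuv_def \<kappa>1_def \<kappa>2_def)
  \<comment> \<open>By \<open>c3n\<close> the third derivative disappears from \<open>c3\<close>: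
    the derivative of the normal curvature equals c'' . n', which is the last hypothesis of
    \<open>darboux_algebra\<close>.\<close>
  have "- (\<kappa>1 s * u' s * (c2 s \<bullet> x s) + \<kappa>2 s * v' s * (c2 s \<bullet> y s))
    = (u' s * d_u (curvature_1 X N) (u s, v s) + v' s * d_v (curvature_1 X N) (u s, v s)) * (cos (\<alpha> s))\<^sup>2
      + (u' s * d_u (curvature_2 X N) (u s, v s) + v' s * d_v (curvature_2 X N) (u s, v s)) * (sin (\<alpha> s))\<^sup>2
      + 2 * (\<kappa>2 s - \<kappa>1 s) * sin (\<alpha> s) * cos (\<alpha> s) * deriv \<alpha> s"
    unfolding c3 [symmetric] c3n by (simp add: inner_diff_right)
  from darboux_algebra [OF pos [OF s] u'_def v'_def
      c2x [unfolded xx' c1x'] c2y [unfolded yy' c1y'] cod this]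
  show "3 * (curvature_1 X N (u s, v s) - curvature_2 X N (u s, v s))
      * sin (\<alpha> s) * cos (\<alpha> s) * deriv \<alpha> s
    = 1 / sqrt (coeff_E X (u s, v s)) * d_u (curvature_1 X N) (u s, v s) * cos (\<alpha> s) ^ 3
      + 1 / sqrt (coeff_G X (u s, v s)) * d_v (curvature_2 X N) (u s, v s) * sin (\<alpha> s) ^ 3"
    unfolding aE bG \<kappa>1_def \<kappa>2_def .
qed

end
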